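(* If $n\geq 3$ is an integer, then $\mathrm{MiD}(L_n)=\left\lfloor\frac{n-1}{2}\right\rfloor$.
   Context: A Latin square of order $n$ is an $n\times n$ array with entries from $\{1,2,\dots,n\}$ such that each row and each column contains every symbol exactly once. Two cells are adjacent if they share an edge horizontally or vertically: $(i_1,j_1)$ and $(i_2,j_2)$ are adjacent if $i_1=i_2$ and $|j_1-j_2|=1$, or $j_1=j_2$ and $|i_1-i_2|=1$ (no wrap-around). The distance between two adjacent cells containing symbols $u,v$ is $\min\{(u-v) \bmod n,\ (v-u)\bmod n\}$, residues being taken in $\{0,\dots,n-1\}$. The inner distance of a Latin square of order $n\ge 2$ is the minimum of the distances over all pairs of adjacent cells. $\mathrm{MiD}(L_n)$ denotes the maximum of the inner distances of all Latin squares of order $n$. *)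

theory Defs
  imports Complex_Main
begin

(* An array of order n is a function of row and column indices; only its values at
   indices in {1..n} matter. *)
definition latin_square :: "nat \<Rightarrow> (nat \<Rightarrow> nat \<Rightarrow> int) \<Rightarrow> bool" where
  "latin_square n L \<longleftrightarrow>
     (\<forall>i\<in>{1..n}. \<forall>j\<in>{1..n}. L i j \<in> {1..int n}) \<and>
     (\<forall>i\<in>{1..n}. \<forall>s\<in>{1..int n}. \<exists>!j. j \<in> {1..n} \<and> L i j = s) \<and>
     (\<forall>j\<in>{1..n}. \<forall>s\<in>{1..int n}. \<exists>!i. i \<in> {1..n} \<and> L i j = s)"

definition cells :: "nat \<Rightarrow> (nat \<times> nat) set" where
  "cells n = {1..n} \<times> {1..n}"

fun adjacent :: "nat \<times> nat \<Rightarrow> nat \<times> nat \<Rightarrow> bool" where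
  "adjacent (i1, j1) (i2, j2) \<longleftrightarrow>
     (i1 = i2 \<and> \<bar>int j1 - int j2\<bar> = 1) \<or> (j1 = j2 \<and> \<bar>int i1 - int i2\<bar> = 1)"

(* For n > 0, mod on int takes values in {0..n-1}, also for negative arguments. *)
definition symbol_distance :: "nat \<Rightarrow> int \<Rightarrow> int \<Rightarrow> int" where
  "symbol_distance n u v = min ((u - v) mod int n) ((v - u) mod int n)"

definition adjacent_distances :: "nat \<Rightarrow> (nat \<Rightarrow> nat \<Rightarrow> int) \<Rightarrow> int set" where
  "adjacent_distances n L =
     {symbol_distance n (L (fst c) (snd c)) (L (fst d) (snd d)) | c d.
        c \<in> cells n \<and> d \<in> cells n \<and> adjacent c d}"

(* Meaningful for n \<ge> 2 only: for smaller n there are no adjacent cells, and Min {} is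
   unspecified. *)
definition inner_distance :: "nat \<Rightarrow> (nat \<Rightarrow> nat \<Rightarrow> int) \<Rightarrow> int" where
  "inner_distance n L = Min (adjacent_distances n L)"

definition MiD :: "nat \<Rightarrow> int" where
  "MiD n = Max {inner_distance n L | L. latin_square n L}"

(* The sets under Min and Max are finite and nonempty for n \<ge> 2. *)

lemma finite_adjacent_distances: "finite (adjacent_distances n L)"
proof -
  have "adjacent_distances n L \<subseteq>
      (\<lambda>(c, d). symbol_distance n (L (fst c) (snd c)) (L (fst d) (snd d))) ` (cells n \<times> cells n)"
    unfolding adjacent_distances_def by (rule subsetI) (force simp del: adjacent.simps)
  then show ?thesis
    by (rule finite_subset) (simp add: cells_def)
qed

lemma adjacent_distances_nonempty:
  assumes "n \<ge> 2"
  shows "adjacent_distances n L \<noteq> {}"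
proof -
  have "(1, 1) \<in> cells n" "(1, 2) \<in> cells n" "adjacent (1, 1) (1, 2)"
    using assms by (auto simp: cells_def)
  then show ?thesis
    unfolding adjacent_distances_def by blast
qed

lemma adjacent_distances_bounds:
  assumes "n \<ge> 2" "x \<in> adjacent_distances n L"
  shows "x \<in> {0..int n}"
proof -
  have "symbol_distance n u v \<in> {0..int n}" for u v
  proof -
    have "0 \<le> x mod int n \<and> x mod int n < int n" for x
      using assms(1) by simp
    from this[of "u - v"] this[of "v - u"] show ?thesis
      unfolding symbol_distance_def by auto
  qed
  then show ?thesis
    using assms(2) unfolding adjacent_distances_def by auto
qed

lemma finite_inner_distances:
  assumes "n \<ge> 2"
  shows "finite {inner_distance n L | L. latin_square n L}"
proof (rule finite_subset)
  show "{inner_distance n L | L. latin_square n L} \<subseteq> {0..int n}"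
    using adjacent_distances_bounds[OF assms]
      Min_in[OF finite_adjacent_distances adjacent_distances_nonempty[OF assms]]
    unfolding inner_distance_def by blast
qed simp

lemma ex1_cyclic:
  assumes "s \<in> {1..int n}"
  shows "\<exists>!j. j \<in> {1..n} \<and> (int i + int j) mod int n + 1 = s"
proof (rule ex_ex1I)
  have n: "int n > 0" using assms by auto
  define k where "k = (s - 2 - int i) mod int n"
  have k: "0 \<le> k" "k < int n" using n by (auto simp: k_def)
  have "(int i + (k + 1)) mod int n = (int i + 1 + (s - 2 - int i)) mod int n"
    unfolding k_def using mod_add_right_eq[of "int i + 1" "s - 2 - int i" "int n"]
    by (simp only: ac_simps)
  also have "\<dots> = s - 1" using assms by (simp add: algebra_simps)
  finally have "(int i + (k + 1)) mod int n = s - 1" .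
  moreover have "int (nat (k + 1)) = k + 1" using k by simp
  moreover have "nat (k + 1) \<in> {1..n}" using k by auto
  ultimately show "\<exists>j. j \<in> {1..n} \<and> (int i + int j) mod int n + 1 = s"
    by (intro exI[of _ "nat (k + 1)"]) auto
next
  fix j j'
  assume a: "j \<in> {1..n} \<and> (int i + int j) mod int n + 1 = s"
    "j' \<in> {1..n} \<and> (int i + int j') mod int n + 1 = s"
  then have "(int i + int j) mod int n = (int i + int j') mod int n" by simp
  then have "int n dvd int j - int j'"
    by (simp add: mod_eq_dvd_iff)
  moreover have "\<bar>int j - int j'\<bar> < int n" using a by auto
  ultimately show "j = j'"
    using dvd_imp_le_int[of "int j - int j'" "int n"] by fastforce
qed

lemma latin_square_exists: "\<exists>L. latin_square n L"
proof
  show "latin_square n (\<lambda>i j. (int i + int j) mod int n + 1)"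
    unfolding latin_square_def
  proof (intro conjI ballI)
    fix i j assume "i \<in> {1..n}" "j \<in> {1..n}"
    then have "0 < int n" by auto
    then show "(int i + int j) mod int n + 1 \<in> {1..int n}"
      using pos_mod_bound[OF \<open>0 < int n\<close>, of "int i + int j"]
        pos_mod_sign[OF \<open>0 < int n\<close>, of "int i + int j"]
      unfolding atLeastAtMost_iff by linarith
  next
    fix i s assume "s \<in> {1..int n}"
    then show "\<exists>!j. j \<in> {1..n} \<and> (int i + int j) mod int n + 1 = s"
      by (rule ex1_cyclic)
  next
    fix j s assume "s \<in> {1..int n}"
    then show "\<exists>!i. i \<in> {1..n} \<and> (int i + int j) mod int n + 1 = s"
      using ex1_cyclic[of s n j] by (simp add: add.commute)
  qed
qed

lemma inner_distances_nonempty: "{inner_distance n L | L. latin_square n L} \<noteq> {}"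
  using latin_square_exists by blast

end

theory Submission
  imports Defs
begin

text \<open>
  Put \<open>k = (n - 1) div 2\<close>.

  Upper bound: two symbols whose cyclic distance exceeds \<open>k\<close> are exactly half a turn apart, which
  in particular forces \<open>n\<close> to be even (\<open>symbol_distance_gt_imp_half_turn\<close>). If all adjacent
  symbols were that far apart, then two consecutive half turns would make the first and the third
  entry of a row equal.

  Lower bound: it suffices to order the residues modulo \<open>n\<close> as \<open>a 1, \<dots>, a n\<close> such that
  consecutive ones are at cyclic distance at least \<open>k\<close>. Then \<open>a i + a j\<close> modulo \<open>n\<close> is a Latin
  square, because \<open>a\<close> is a bijection, and the difference of two adjacent entries is a difference of
  two consecutive values of \<open>a\<close>. Interleaving the lower and the upper half of the residues, as in
  \<open>0, k + 1, 1, k + 2, 2, \<dots>\<close>, is such an ordering for either parity of \<open>n\<close>: its steps are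
  alternately \<open>k + 1\<close> and \<open>-k\<close>.
\<close>

text \<open>
  The two residues \<open>(u - v) mod n\<close> and \<open>(v - u) mod n\<close> add up to \<open>n\<close> unless they vanish, so both
  can exceed \<open>(n - 1) div 2\<close> only if they are equal.
\<close>
lemma symbol_distance_gt_imp_half_turn:
  assumes "n > 0" and "symbol_distance n u v > (int n - 1) div 2"
  shows "2 * ((u - v) mod int n) = int n"
proof -
  define d where "d = (u - v) mod int n"
  have gt: "d > (int n - 1) div 2" "(v - u) mod int n > (int n - 1) div 2"
    using assms(2) by (auto simp: symbol_distance_def d_def)
  have "d \<noteq> 0" using gt(1) assms(1) by linarith
  then have "(v - u) mod int n = int n - d"
    using zmod_zminus1_eq_if[of "u - v" "int n"] by (simp add: d_def)
  then show ?thesis using gt unfolding d_def by linarith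
qed

lemma inner_distance_le:
  assumes "c \<in> cells n" "d \<in> cells n" "adjacent c d"
  shows "inner_distance n L \<le> symbol_distance n (L (fst c) (snd c)) (L (fst d) (snd d))"
  unfolding inner_distance_def
  by (rule Min_le[OF finite_adjacent_distances]) (use assms in \<open>unfold adjacent_distances_def, blast\<close>)

lemma inner_distance_upper_bound:
  assumes n: "n \<ge> 3" and L: "latin_square n L"
  shows "inner_distance n L \<le> (int n - 1) div 2"
proof (rule ccontr)
  assume "\<not> ?thesis"
  then have gt: "inner_distance n L > (int n - 1) div 2" by simp
  have "inner_distance n L \<le> symbol_distance n (L 1 1) (L 1 2)"
    using inner_distance_le[of "(1, 1)" n "(1, 2)" L] n by (simp add: cells_def)
  with gt n have half1: "2 * ((L 1 1 - L 1 2) mod int n) = int n"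
    by (intro symbol_distance_gt_imp_half_turn) auto
  have "inner_distance n L \<le> symbol_distance n (L 1 2) (L 1 3)"
    using inner_distance_le[of "(1, 2)" n "(1, 3)" L] n by (simp add: cells_def)
  with gt n have half2: "2 * ((L 1 2 - L 1 3) mod int n) = int n"
    by (intro symbol_distance_gt_imp_half_turn) auto
  have "(L 1 1 - L 1 3) mod int n
      = ((L 1 1 - L 1 2) mod int n + (L 1 2 - L 1 3) mod int n) mod int n"
    by (simp add: mod_add_eq)
  also have "(L 1 1 - L 1 2) mod int n + (L 1 2 - L 1 3) mod int n = int n"
    using half1 half2 by linarith
  finally have dvd: "int n dvd L 1 1 - L 1 3" by (simp add: dvd_eq_mod_eq_0)
  have range: "L 1 1 \<in> {1..int n}" "L 1 3 \<in> {1..int n}"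
    using L n by (auto simp: latin_square_def)
  then have "\<bar>L 1 1 - L 1 3\<bar> < int n" by auto
  with dvd have "L 1 1 = L 1 3"
    using dvd_imp_le_int[of "L 1 1 - L 1 3" "int n"] by fastforce
  moreover have "\<exists>!j. j \<in> {1..n} \<and> L 1 j = L 1 1"
    using L n range(1) unfolding latin_square_def by auto
  ultimately have "(1::nat) = 3"
    using n by (metis atLeastAtMost_iff le_trans one_le_numeral order_refl)
  then show False by simp
qed

definition sum_square :: "nat \<Rightarrow> (nat \<Rightarrow> int) \<Rightarrow> nat \<Rightarrow> nat \<Rightarrow> int" where
  "sum_square n a i j = (a i + a j) mod int n + 1"

lemma latin_square_sum_square:
  assumes a: "bij_betw a {1..n} {0..<int n}"
  shows "latin_square n (sum_square n a)"
proof -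
  have ex1: "\<exists>!j. j \<in> {1..n} \<and> (t + a j) mod int n + 1 = s" if s: "s \<in> {1..int n}" for s t
  proof -
    have solution: "(t + x) mod int n + 1 = s \<longleftrightarrow> x = (s - 1 - t) mod int n"
      if x: "x \<in> {0..<int n}" for x
    proof -
      have "(t + x) mod int n + 1 = s \<longleftrightarrow> (t + x) mod int n = (s - 1) mod int n"
        using s by auto
      also have "\<dots> \<longleftrightarrow> x mod int n = (s - 1 - t) mod int n"
        by (simp add: mod_eq_dvd_iff algebra_simps)
      finally show ?thesis using x by simp
    qed
    have "(s - 1 - t) mod int n \<in> {0..<int n}" using s by simp
    then have "\<exists>!j. j \<in> {1..n} \<and> a j = (s - 1 - t) mod int n"
      using a unfolding bij_betw_def inj_on_def by (metis imageE)
    moreover have "a j \<in> {0..<int n}" if "j \<in> {1..n}" for j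
      using a that by (rule bij_betwE[rule_format])
    ultimately show ?thesis using solution by metis
  qed
  have "sum_square n a i j \<in> {1..int n}" if "i \<in> {1..n}" for i j
  proof -
    have "0 < int n" using that by auto
    then have "0 \<le> (a i + a j) mod int n" "(a i + a j) mod int n < int n" by simp_all
    then show ?thesis by (simp add: sum_square_def)
  qed
  moreover have "\<exists>!i. i \<in> {1..n} \<and> sum_square n a i j = s" if "s \<in> {1..int n}" for j s
    using ex1[OF that, of "a j"] by (simp add: sum_square_def add.commute)
  ultimately show ?thesis
    using ex1 by (auto simp: latin_square_def sum_square_def)
qed

lemma symbol_distance_commute: "symbol_distance n u v = symbol_distance n v u"
  by (simp add: symbol_distance_def min.commute)

lemma symbol_distance_sum_square:
  "symbol_distance n (sum_square n a i j) (sum_square n a i j') = symbol_distance n (a j) (a j')"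
  "symbol_distance n (sum_square n a i j) (sum_square n a i' j) = symbol_distance n (a i) (a i')"
  by (simp_all add: symbol_distance_def sum_square_def mod_diff_eq)

lemma inner_distance_sum_square_ge:
  assumes n: "n \<ge> 2"
    and step: "\<And>j. \<lbrakk>1 \<le> j; j < n\<rbrakk> \<Longrightarrow> symbol_distance n (a j) (a (Suc j)) \<ge> k"
  shows "inner_distance n (sum_square n a) \<ge> k"
proof -
  have far: "symbol_distance n (a j) (a j') \<ge> k"
    if "j \<in> {1..n}" "j' \<in> {1..n}" "\<bar>int j - int j'\<bar> = 1" for j j'
  proof -
    from that(3) consider "j' = Suc j" | "j = Suc j'" by linarith
    then show ?thesis
      using step[of j] step[of j'] that(1,2) symbol_distance_commute[of n "a j" "a j'"]
      by cases simp_all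
  qed
  have "x \<ge> k" if "x \<in> adjacent_distances n (sum_square n a)" for x
    using that far unfolding adjacent_distances_def cells_def
    by (auto simp: symbol_distance_sum_square)
  then show ?thesis
    using Min_in[OF finite_adjacent_distances adjacent_distances_nonempty[OF n]]
    unfolding inner_distance_def by blast
qed

text \<open>
  The positions are \<open>1, \<dots>, n\<close>, so odd positions run through \<open>0, \<dots>, k\<close> and even positions, whose
  half is at least \<open>1\<close>, through \<open>k + 1, \<dots>, n - 1\<close>, where \<open>k = (n - 1) div 2\<close>.
\<close>
definition interleaving :: "nat \<Rightarrow> nat \<Rightarrow> int" where
  "interleaving n j = (if odd j then int j div 2 else (int n - 1) div 2 + int j div 2)"

lemma bij_betw_interleaving: "bij_betw (interleaving n) {1..n} {0..<int n}"
proof -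
  have inj: "inj_on (interleaving n) {1..n}"
  proof (rule inj_onI)
    fix i j assume ij: "i \<in> {1..n}" "j \<in> {1..n}" and eq: "interleaving n i = interleaving n j"
    show "i = j"
      using ij eq unfolding interleaving_def atLeastAtMost_iff
      by (auto split: if_splits elim!: oddE evenE)
  qed
  have "interleaving n ` {1..n} \<subseteq> {0..<int n}"
  proof (rule image_subsetI)
    fix j assume "j \<in> {1..n}"
    then show "interleaving n j \<in> {0..<int n}"
      by (auto simp: interleaving_def elim!: oddE evenE)
  qed
  moreover have "card (interleaving n ` {1..n}) = card {0..<int n}"
    using card_image[OF inj] by simp
  ultimately have "interleaving n ` {1..n} = {0..<int n}"
    by (intro card_subset_eq) auto
  with inj show ?thesis by (simp add: bij_betw_def)
qed

text \<open>
  Both \<open>k\<close> and \<open>k + 1\<close> lie between \<open>k\<close> and \<open>n - k\<close>, because \<open>2 * k + 1 \<le> n\<close>; so a step of either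
  length, in either direction, covers a cyclic distance of at least \<open>k\<close>.
\<close>
lemma symbol_distance_interleaving_Suc:
  assumes n: "n \<ge> 2"
  shows "symbol_distance n (interleaving n j) (interleaving n (Suc j)) \<ge> (int n - 1) div 2"
proof -
  define k where "k = (int n - 1) div 2"
  have k: "0 \<le> k" "2 * k + 1 \<le> int n" "k + 1 < int n"
    using n unfolding k_def by linarith+
  have far: "symbol_distance n u v \<ge> k" if "v - u = k \<or> v - u = k + 1" for u v
  proof -
    define x where "x = v - u"
    have x: "k \<le> x" "x \<le> k + 1" using that by (auto simp: x_def)
    have mod_x: "x mod int n = x" using x k by simp
    have "(- x) mod int n \<ge> k"
    proof (cases "x = 0")
      case False
      with mod_x have "(- x) mod int n = int n - x" by (simp add: zmod_zminus1_eq_if)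
      then show ?thesis using x k by simp
    qed (use x in simp)
    then show ?thesis using mod_x x by (simp add: symbol_distance_def x_def)
  qed
  show ?thesis
  proof (cases "odd j")
    case True
    then have "interleaving n (Suc j) - interleaving n j = k + 1"
      by (auto simp: interleaving_def k_def elim!: oddE evenE)
    then show ?thesis using far unfolding k_def by blast
  next
    case False
    then have "interleaving n j - interleaving n (Suc j) = k"
      by (auto simp: interleaving_def k_def elim!: oddE evenE)
    then show ?thesis using far symbol_distance_commute unfolding k_def by metis
  qed
qed

theorem theorem2p5:
  fixes n :: nat
  assumes "n \<ge> 3"
  shows "MiD n = \<lfloor>(real n - 1) / 2\<rfloor>"
proof -
  define k where "k = (int n - 1) div 2"
  define L where "L = sum_square n (interleaving n)"
  have n: "n \<ge> 2" using assms by simp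
  have L: "latin_square n L"
    unfolding L_def by (rule latin_square_sum_square[OF bij_betw_interleaving])
  have "k \<le> inner_distance n L"
    unfolding L_def k_def
    by (intro inner_distance_sum_square_ge symbol_distance_interleaving_Suc n)
  moreover have upper: "inner_distance n M \<le> k" if "latin_square n M" for M
    using inner_distance_upper_bound[OF assms that] by (simp add: k_def)
  ultimately have "inner_distance n L = k" using L by (simp add: order_antisym)
  with L upper have "MiD n = k"
    unfolding MiD_def by (intro Max_eqI finite_inner_distances[OF n]) auto
  also have "k = \<lfloor>(real n - 1) / 2\<rfloor>"
    unfolding k_def using floor_divide_of_int_eq[of "int n - 1" 2, where ?'a = real] by simp
  finally show ?thesis .
qed

end
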